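(* Let $f\colon X\to\mathbb{R}$ be a filter on a Lefschetz complex, and let $(V_i)_{i\ge 0}$ be a sequence of shallow cancellations with associated sequence of filtered Lefschetz complexes $(X_i,f_i)_{i\ge 0}$. Assume that $V_i\neq\emptyset$ unless $X_i$ is boundaryless. Then there exists a non-negative integer $n$ such that $X_n$ is boundaryless and $$\mathrm{BD}(f)=V_0\sqcup V_1\sqcup\dots\sqcup V_{n-1}$$ is a decomposition of $\mathrm{BD}(f)$ into mutually disjoint sets.
   Context: Fix a field $\mathbb{F}$. A Lefschetz complex is a triple $(X,\dim,\kappa)$ with $X$ a finite set (of cells), $\dim\colon X\to\mathbb{Z}$, and an incidence map $\kappa\colon X\times X\to\mathbb{F}$ such that $\sum_{y\in X}\kappa(z,y)\kappa(y,x)=0$ for all $z,x\in X$, and $\kappa(y,x)\neq 0$ only if $\dim y=\dim x+1$. If $\kappa(y,x)\ne 0$, then $x$ is a facet of $y$ and $y$ is a cofacet of $x$. $X$ is boundaryless if $\kappa=0$. A filter on $X$ is an injective map $f\colon X\to\mathbb{R}$ with $f(x)<f(y)$ whenever $x$ is a facet of $y$; $(X,f)$ is then a filtered Lefschetz complex. Birth-death pairs: order $X$ by $f$ and let $\Delta$ be the matrix with rows and columns indexed by $X$ in this order, $\Delta[x,y]=\kappa(y,x)$. A reduced form of $\Delta$ is a matrix $R=\Delta\cdot V$ with $V-\mathrm{Id}$ strictly upper triangular and such that the pivots (lowest non-zero entries) of the non-zero columns of $R$ lie in pairwise different rows. $\mathrm{BD}(f)$ is the set of pairs $(s,t)\in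 X\times X$ such that column $t$ of $R$ is non-zero and its pivot is in row $s$; this does not depend on the choice of $R$. Shallow pairs: $\mathrm{SH}(f)$ is the set of pairs $(s,t)$ such that $s$ is a facet of $t$, $f(x)\le f(s)$ for all facets $x$ of $t$, and $f(y)\ge f(t)$ for all cofacets $y$ of $s$. Cancellation: if $s$ is a facet of $t$, the quotient of $X$ by $(s,t)$ is the Lefschetz complex with cells $X\setminus\{s,t\}$, restricted dimension map, and incidence map $\kappa'(y,x)=\kappa(y,x)-\kappa(t,s)^{-1}\kappa(y,s)\kappa(t,x)$. For $V\subseteq\mathrm{SH}(f)$, $X/V$ denotes the Lefschetz complex obtained by canceling all pairs of $V$ one after the other; this is well defined, does not depend on the order in which the pairs are canceled, and $f|_{X/V}$ is a filter on $X/V$. A sequence of shallow cancellations $(V_i)_i$ with associated sequence $(X_i,f_i)_i$ is defined recursively by $X_0=X$, $f_0=f$, $V_0\subseteq\mathrm{SH}(f_0)$, and $X_{i+1}=X_i/V_i$, $f_{i+1}=f_i|_{X_{i+1}}$, $V_{i+1}\subseteq\mathrm{SH}(f_{i+1})$. *)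

theory Defs
  imports Complex_Main "HOL-Library.Disjoint_Sets"
begin

text \<open>
  The incidence map is a total function on the type of cells, but only its values on
  pairs of elements of \<open>cells X\<close> are ever used; the same holds for the
  dimension map and for filters. In particular, the restriction of a filter
  \<open>f\<close> to a smaller complex is represented by \<open>f\<close> itself.
\<close>

record ('a, 'k) complex_data =
  cells :: "'a set"
  cell_dim :: "'a \<Rightarrow> int"
  inc :: "'a \<Rightarrow> 'a \<Rightarrow> 'k"

definition lefschetz_complex :: "('a, 'k::field) complex_data \<Rightarrow> bool" where
  "lefschetz_complex X \<longleftrightarrow>
     finite (cells X) \<and>
     (\<forall>z\<in>cells X. \<forall>x\<in>cells X. (\<Sum>y\<in>cells X. inc X z y * inc X y x) = 0) \<and>
     (\<forall>y\<in>cells X. \<forall>x\<in>cells X. inc X y x \<noteq> 0 \<longrightarrow> cell_dim X y = cell_dim X x + 1)"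

definition facet :: "('a, 'k::field) complex_data \<Rightarrow> 'a \<Rightarrow> 'a \<Rightarrow> bool" where
  "facet X x y \<longleftrightarrow> x \<in> cells X \<and> y \<in> cells X \<and> inc X y x \<noteq> 0"

definition boundaryless :: "('a, 'k::field) complex_data \<Rightarrow> bool" where
  "boundaryless X \<longleftrightarrow> (\<forall>y\<in>cells X. \<forall>x\<in>cells X. inc X y x = 0)"

definition is_filter_on :: "('a, 'k::field) complex_data \<Rightarrow> ('a \<Rightarrow> real) \<Rightarrow> bool" where
  "is_filter_on X f \<longleftrightarrow> inj_on f (cells X) \<and> (\<forall>x y. facet X x y \<longrightarrow> f x < f y)"


subsection \<open>Birth-death pairs\<close>

text \<open>
  Matrices are indexed by the cells (row first), in the order given by \<open>f\<close>.
  Hence ``strictly above the diagonal'' means \<open>f x < f y\<close> for row \<open>x\<close> and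
  column \<open>y\<close>, and the lowest non-zero entry of a column is the one whose row has
  the largest value of \<open>f\<close>.
\<close>

definition boundary_matrix :: "('a, 'k::field) complex_data \<Rightarrow> 'a \<Rightarrow> 'a \<Rightarrow> 'k" where
  "boundary_matrix X x y = inc X y x"

definition cell_mat_mult ::
    "('a, 'k::field) complex_data \<Rightarrow> ('a \<Rightarrow> 'a \<Rightarrow> 'k) \<Rightarrow> ('a \<Rightarrow> 'a \<Rightarrow> 'k) \<Rightarrow> 'a \<Rightarrow> 'a \<Rightarrow> 'k" where
  "cell_mat_mult X A B x z = (\<Sum>y\<in>cells X. A x y * B y z)"

definition identity_matrix :: "'a \<Rightarrow> 'a \<Rightarrow> 'k::field" where
  "identity_matrix x y = (if x = y then 1 else 0)"

definition strictly_upper_triangular ::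
    "('a, 'k::field) complex_data \<Rightarrow> ('a \<Rightarrow> real) \<Rightarrow> ('a \<Rightarrow> 'a \<Rightarrow> 'k) \<Rightarrow> bool" where
  "strictly_upper_triangular X f A \<longleftrightarrow>
     (\<forall>x\<in>cells X. \<forall>y\<in>cells X. A x y \<noteq> 0 \<longrightarrow> f x < f y)"

definition pivot_in_row ::
    "('a, 'k::field) complex_data \<Rightarrow> ('a \<Rightarrow> real) \<Rightarrow> ('a \<Rightarrow> 'a \<Rightarrow> 'k) \<Rightarrow> 'a \<Rightarrow> 'a \<Rightarrow> bool" where
  "pivot_in_row X f R s t \<longleftrightarrow>
     s \<in> cells X \<and> t \<in> cells X \<and> R s t \<noteq> 0 \<and> (\<forall>x\<in>cells X. R x t \<noteq> 0 \<longrightarrow> f x \<le> f s)"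

definition reduced_form ::
    "('a, 'k::field) complex_data \<Rightarrow> ('a \<Rightarrow> real) \<Rightarrow> ('a \<Rightarrow> 'a \<Rightarrow> 'k) \<Rightarrow> bool" where
  "reduced_form X f R \<longleftrightarrow>
     (\<exists>V. R = cell_mat_mult X (boundary_matrix X) V \<and>
          strictly_upper_triangular X f (\<lambda>x y. V x y - identity_matrix x y)) \<and>
     (\<forall>s t t'. pivot_in_row X f R s t \<and> pivot_in_row X f R s t' \<longrightarrow> t = t')"

text \<open>
  The definite description expresses that the set of pairs does not depend on the reduced form.
\<close>

definition BD :: "('a, 'k::field) complex_data \<Rightarrow> ('a \<Rightarrow> real) \<Rightarrow> ('a \<times> 'a) set" where
  "BD X f = (THE B. \<exists>R. reduced_form X f R \<and> B = {(s, t). pivot_in_row X f R s t})"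


subsection \<open>Shallow pairs and cancellations\<close>

definition SH :: "('a, 'k::field) complex_data \<Rightarrow> ('a \<Rightarrow> real) \<Rightarrow> ('a \<times> 'a) set" where
  "SH X f = {(s, t). facet X s t \<and> (\<forall>x. facet X x t \<longrightarrow> f x \<le> f s) \<and>
                     (\<forall>y. facet X s y \<longrightarrow> f y \<ge> f t)}"

definition cancel ::
    "'a \<times> 'a \<Rightarrow> ('a, 'k::field) complex_data \<Rightarrow> ('a, 'k) complex_data" where
  "cancel = (\<lambda>(s, t) X.
     \<lparr> cells = cells X - {s, t},
       cell_dim = cell_dim X,
       inc = (\<lambda>y x. inc X y x - inverse (inc X t s) * inc X y s * inc X t x) \<rparr>)"

text \<open>
  \<open>is_quotient X V Y\<close> says that \<open>Y\<close> is obtained from \<open>X\<close> by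
  canceling the pairs of \<open>V\<close> one after the other, in some order. It is only used for
  sets \<open>V\<close> of shallow pairs. Such pairs are mutually disjoint and canceling one of
  them does not change the incidence of another one, so that \<open>s\<close> is still a facet of
  \<open>t\<close> whenever a pair \<open>(s, t)\<close> gets canceled; and on the cells of
  \<open>Y\<close> the result does not depend on the order.
\<close>

definition is_quotient ::
    "('a, 'k::field) complex_data \<Rightarrow> ('a \<times> 'a) set \<Rightarrow> ('a, 'k) complex_data \<Rightarrow> bool" where
  "is_quotient X V Y \<longleftrightarrow> (\<exists>ps. distinct ps \<and> set ps = V \<and> Y = fold cancel ps X)"

definition shallow_cancellations ::
    "('a, 'k::field) complex_data \<Rightarrow> ('a \<Rightarrow> real) \<Rightarrow> (nat \<Rightarrow> ('a, 'k) complex_data) \<Rightarrow>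
     (nat \<Rightarrow> ('a \<times> 'a) set) \<Rightarrow> bool" where
  "shallow_cancellations X f Xs V \<longleftrightarrow>
     Xs 0 = X \<and> (\<forall>i. V i \<subseteq> SH (Xs i) f \<and> is_quotient (Xs i) (V i) (Xs (Suc i)))"

end

theory Submission
  imports Defs
begin

text \<open>
  Canceling a shallow pair \<open>(s, t)\<close> removes exactly that pair from the set of birth-death
  pairs; the theorem is this fact iterated until no incidence is left. To see it, read a matrix as
  a family of chains, one for each column. The quotient \<open>Y\<close> of \<open>X\<close> comes with a
  chain map from the chains of \<open>Y\<close> to those of \<open>X\<close> that sends a cell \<open>y\<close> to
  \<open>y\<close> minus the multiple of \<open>t\<close> that removes \<open>s\<close> from its boundary
  (\<open>boundary_lift\<close>). Given a reduced form of \<open>Y\<close>, apply this map to the columns of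
  its change-of-basis matrix and add two columns for the canceled cells: the chain \<open>t\<close>,
  whose boundary has its pivot in row \<open>s\<close>, and a multiple of the boundary of \<open>t\<close>,
  which is a cycle with leading cell \<open>s\<close>. Shallowness is what makes all of this respect
  the order: the map only adds \<open>t\<close> to chains that contain a cell later than \<open>t\<close>, hence
  it changes neither leading cells nor pivots, and \<open>s\<close> is the last facet of
  \<open>t\<close>. The result is a reduced form of \<open>X\<close> with \<open>(s, t)\<close> as its only
  additional pivot (\<open>reduced_form_lift\<close>).

  Shallow pairs are mutually disjoint and the remaining ones stay shallow when one of them is
  canceled (\<open>shallow_pairs_disjoint\<close>, \<open>shallow_pair_survives\<close>), so this applies to all
  pairs of a set \<open>V i\<close> in turn (\<open>fold_cancel\<close>). The number of cells drops as long as the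
  complex has a boundary, so some \<open>Xs n\<close> is boundaryless; its zero matrix is reduced and has no
  pivots. Lifting from there back to \<open>X\<close> yields a reduced form of \<open>X\<close> with the
  pivots \<open>V 0, \<dots>, V (n - 1)\<close>. All reduced forms have the same pivots
  (\<open>pivots_subset\<close>), because the pivot of a non-zero column \<open>t\<close> is, in the
  order given by \<open>f\<close>, the first among those of all boundaries of chains with leading cell
  \<open>t\<close> (\<open>pivot_minimal\<close>).
\<close>


section \<open>The pivots of a reduced form\<close>

definition pivots :: "('a, 'k::field) complex_data \<Rightarrow> ('a \<Rightarrow> real) \<Rightarrow> ('a \<Rightarrow> 'a \<Rightarrow> 'k) \<Rightarrow> ('a \<times> 'a) set" where
  "pivots X f R = {(s, t). pivot_in_row X f R s t}"

definition chain_boundary :: "('a, 'k::field) complex_data \<Rightarrow> ('a \<Rightarrow> 'k) \<Rightarrow> 'a \<Rightarrow> 'k" where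
  "chain_boundary X c x = (\<Sum>y\<in>cells X. inc X y x * c y)"

definition unitriangular :: "('a, 'k::field) complex_data \<Rightarrow> ('a \<Rightarrow> real) \<Rightarrow> ('a \<Rightarrow> 'a \<Rightarrow> 'k) \<Rightarrow> bool" where
  "unitriangular X f V \<longleftrightarrow> (\<forall>x\<in>cells X. V x x = 1) \<and>
     (\<forall>x\<in>cells X. \<forall>y\<in>cells X. V x y \<noteq> 0 \<longrightarrow> f x \<le> f y)"

lemma unitriangular_iff:
  assumes "inj_on f (cells X)"
  shows "strictly_upper_triangular X f (\<lambda>x y. V x y - identity_matrix x y) \<longleftrightarrow> unitriangular X f V"
proof
  assume L: "strictly_upper_triangular X f (\<lambda>x y. V x y - identity_matrix x y)"
  show "unitriangular X f V"
    unfolding unitriangular_def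
  proof (intro conjI ballI impI)
    fix x assume "x \<in> cells X"
    then show "V x x = 1"
      using L by (force simp: strictly_upper_triangular_def identity_matrix_def)
  next
    fix x y assume "x \<in> cells X" "y \<in> cells X" "V x y \<noteq> 0"
    then show "f x \<le> f y"
      using L by (cases "x = y") (force simp: strictly_upper_triangular_def identity_matrix_def)+
  qed
next
  assume "unitriangular X f V"
  then show "strictly_upper_triangular X f (\<lambda>x y. V x y - identity_matrix x y)"
    using assms unfolding strictly_upper_triangular_def unitriangular_def identity_matrix_def
    by (auto simp: order_less_le dest: inj_onD)
qed

lemma reduced_form_iff:
  assumes "inj_on f (cells X)"
  shows "reduced_form X f R \<longleftrightarrow>
    (\<exists>V. R = (\<lambda>x u. chain_boundary X (\<lambda>y. V y u) x) \<and> unitriangular X f V) \<and>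
    inj_on fst (pivots X f R)"
  unfolding reduced_form_def unitriangular_iff[OF assms]
  by (auto simp: fun_eq_iff cell_mat_mult_def boundary_matrix_def chain_boundary_def
      pivots_def inj_on_def)

lemma finite_max_exists:
  fixes f :: "'b \<Rightarrow> real"
  assumes "finite A" "A \<noteq> {}"
  obtains m where "m \<in> A" "\<And>y. y \<in> A \<Longrightarrow> f y \<le> f m"
proof -
  have "Max (f ` A) \<in> f ` A" using assms by simp
  then obtain m where "m \<in> A" "f m = Max (f ` A)" by auto
  then show thesis using that[of m] assms by simp
qed

lemma pivot_exists:
  assumes "finite (cells X)" "x \<in> cells X" "t \<in> cells X" "R x t \<noteq> 0"
  obtains s where "(s, t) \<in> pivots X f R" "f x \<le> f s"
proof -
  let ?A = "{x \<in> cells X. R x t \<noteq> 0}"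
  have "finite ?A" "?A \<noteq> {}" using assms by auto
  then obtain s where s: "s \<in> ?A" "\<And>y. y \<in> ?A \<Longrightarrow> f y \<le> f s"
    using finite_max_exists[of ?A f] by blast
  show thesis
    using that[of s] s assms unfolding pivots_def pivot_in_row_def by auto
qed

text \<open>
  Subtracting \<open>c t\<close> times column \<open>t\<close> cancels the coefficient at \<open>t\<close>, leaving
  a chain supported on cells before \<open>t\<close>. The value \<open>a t = c t\<close> is recorded because it
  guarantees that column \<open>t\<close> takes part in the combination.
\<close>

lemma unitriangular_spans:
  assumes fin: "finite (cells X)" and inj: "inj_on f (cells X)" and V: "unitriangular X f V"
    and t: "t \<in> cells X"
    and supp: "\<And>x. x \<in> cells X \<Longrightarrow> c x \<noteq> 0 \<Longrightarrow> f x \<le> f t"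
  shows "\<exists>a. a t = c t \<and> (\<forall>u\<in>cells X. a u \<noteq> 0 \<longrightarrow> f u \<le> f t) \<and>
             (\<forall>x\<in>cells X. c x = (\<Sum>u\<in>cells X. V x u * a u))"
  using t supp
proof (induction "card {x \<in> cells X. f x < f t}" arbitrary: t c rule: less_induct)
  case less
  define d where "d x = c x - V x t * c t" for x
  have d_supp: "f x < f t" if "x \<in> cells X" "d x \<noteq> 0" for x
  proof -
    have "x \<noteq> t"
      using that V by (auto simp: d_def unitriangular_def)
    moreover have "f x \<le> f t"
      using that less.prems V
      by (cases "c x = 0") (auto simp: d_def unitriangular_def)
    ultimately show ?thesis
      using inj less.prems(1) that(1) by (metis inj_on_def order_less_le)
  qed
  have sum_delta: "(\<Sum>u\<in>cells X. V x u * (if u = t then c t else 0)) = V x t * c t" for x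
    using fin less.prems(1) by (simp add: if_distrib sum.delta cong: if_cong)
  have "\<exists>b. (\<forall>u\<in>cells X. b u \<noteq> 0 \<longrightarrow> f u < f t) \<and>
             (\<forall>x\<in>cells X. d x = (\<Sum>u\<in>cells X. V x u * b u))"
  proof (cases "\<exists>x\<in>cells X. d x \<noteq> 0")
    case False
    then show ?thesis by (intro exI[of _ "\<lambda>_. 0"]) auto
  next
    case True
    let ?A = "{x \<in> cells X. d x \<noteq> 0}"
    have "finite ?A" "?A \<noteq> {}" using fin True by auto
    then obtain u where u: "u \<in> ?A" "\<And>y. y \<in> ?A \<Longrightarrow> f y \<le> f u"
      using finite_max_exists[of ?A f] by blast
    have lt: "f u < f t" using d_supp u(1) by auto
    then have "{x \<in> cells X. f x < f u} \<subset> {x \<in> cells X. f x < f t}"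
      using u(1) by auto
    then have "card {x \<in> cells X. f x < f u} < card {x \<in> cells X. f x < f t}"
      using fin by (intro psubset_card_mono) auto
    from less.hyps[OF this, of d] u obtain b where
      "\<forall>w\<in>cells X. b w \<noteq> 0 \<longrightarrow> f w \<le> f u"
      "\<forall>x\<in>cells X. d x = (\<Sum>u\<in>cells X. V x u * b u)"
      by auto
    then show ?thesis using lt by fastforce
  qed
  then obtain b where b: "\<forall>u\<in>cells X. b u \<noteq> 0 \<longrightarrow> f u < f t"
    "\<forall>x\<in>cells X. d x = (\<Sum>u\<in>cells X. V x u * b u)" by auto
  have bt: "b t = 0" using b(1) less.prems(1) by auto
  show ?case
  proof (intro exI[of _ "\<lambda>u. b u + (if u = t then c t else 0)"] conjI ballI impI)
    fix x assume x: "x \<in> cells X"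
    have "c x = d x + V x t * c t" by (simp add: d_def)
    also have "\<dots> = (\<Sum>u\<in>cells X. V x u * (b u + (if u = t then c t else 0)))"
      using b(2) x by (simp only: distrib_left sum.distrib sum_delta)
    finally show "c x = \<dots>" .
  next
    fix u assume "u \<in> cells X" "b u + (if u = t then c t else 0) \<noteq> 0"
    then show "f u \<le> f t" using b(1) by (force split: if_splits)
  qed (simp add: bt)
qed

lemma chain_boundary_sum:
  assumes "\<And>y. y \<in> cells X \<Longrightarrow> c y = (\<Sum>u\<in>A. V y u * a u)"
  shows "chain_boundary X c x = (\<Sum>u\<in>A. chain_boundary X (\<lambda>y. V y u) x * a u)"
proof -
  have "chain_boundary X c x = (\<Sum>y\<in>cells X. \<Sum>u\<in>A. inc X y x * V y u * a u)"
    using assms by (simp add: chain_boundary_def sum_distrib_left mult.assoc)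
  also have "\<dots> = (\<Sum>u\<in>A. \<Sum>y\<in>cells X. inc X y x * V y u * a u)"
    by (rule sum.swap)
  finally show ?thesis
    by (simp add: chain_boundary_def sum_distrib_right)
qed

text \<open>
  Write \<open>c\<close> as a combination of the columns of \<open>V\<close>, so that its boundary is the same
  combination of the columns of \<open>R\<close>. Since distinct columns have distinct pivots, the largest
  pivot among the columns involved cannot cancel, and column \<open>t\<close> is one of them.
\<close>

lemma pivot_minimal:
  assumes fin: "finite (cells X)" and inj: "inj_on f (cells X)" and V: "unitriangular X f V"
    and R: "R = (\<lambda>x u. chain_boundary X (\<lambda>y. V y u) x)"
    and red: "inj_on fst (pivots X f R)"
    and st: "(s, t) \<in> pivots X f R"
    and c: "c t \<noteq> 0" "\<And>x. x \<in> cells X \<Longrightarrow> c x \<noteq> 0 \<Longrightarrow> f x \<le> f t"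
  shows "\<exists>x\<in>cells X. chain_boundary X c x \<noteq> 0 \<and> f s \<le> f x"
proof -
  have t: "t \<in> cells X" using st by (auto simp: pivots_def pivot_in_row_def)
  obtain a where a: "a t = c t" "\<forall>x\<in>cells X. c x = (\<Sum>u\<in>cells X. V x u * a u)"
    using unitriangular_spans[OF fin inj V t c(2)] by blast
  let ?P = "{(p, u) \<in> pivots X f R. a u \<noteq> 0}"
  have "?P \<subseteq> cells X \<times> cells X" by (auto simp: pivots_def pivot_in_row_def)
  then have "finite ?P" using fin finite_subset by blast
  moreover have stP: "(s, t) \<in> ?P" using st c a by auto
  ultimately obtain q where q: "q \<in> ?P" "\<And>y. y \<in> ?P \<Longrightarrow> f (fst y) \<le> f (fst q)"
    using finite_max_exists[of ?P "\<lambda>y. f (fst y)"] by blast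
  obtain p u where pu: "q = (p, u)" by force
  have p: "p \<in> cells X" "u \<in> cells X" "R p u \<noteq> 0" "a u \<noteq> 0"
    using q(1) pu by (auto simp: pivots_def pivot_in_row_def)
  \<comment> \<open>A column that is non-zero in row \<open>p\<close> has its pivot in row \<open>p\<close> or a later one,
    hence at \<open>p\<close> by maximality.\<close>
  have other: "R p w * a w = 0" if w: "w \<in> cells X" "w \<noteq> u" for w
  proof (rule ccontr)
    assume *: "R p w * a w \<noteq> 0"
    then obtain p' where p': "(p', w) \<in> pivots X f R" "f p \<le> f p'"
      using pivot_exists[of X p w R f] fin p w by auto
    then have "f p' \<le> f p" using q(2)[of "(p', w)"] * pu by auto
    then have "p' = p"
      using p' p inj by (auto simp: pivots_def pivot_in_row_def dest: inj_onD)
    then show False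
      using inj_onD[OF red, of "(p, w)" "(p, u)"] p' q(1) pu w by auto
  qed
  have "chain_boundary X c p = (\<Sum>w\<in>cells X. R p w * a w)"
    unfolding R using a(2) by (intro chain_boundary_sum) auto
  also have "\<dots> = R p u * a u + (\<Sum>w\<in>cells X - {u}. R p w * a w)"
    using fin p by (simp add: sum.remove[of _ u])
  also have "(\<Sum>w\<in>cells X - {u}. R p w * a w) = 0"
    by (rule sum.neutral) (use other in blast)
  finally show ?thesis
    using p q(2)[OF stP] pu by (intro bexI[of _ p]) auto
qed

text \<open>
  Column \<open>t\<close> of either change-of-basis matrix is a chain with leading cell \<open>t\<close>, so
  minimality of pivots applies in both directions.
\<close>

lemma pivots_subset:
  assumes fin: "finite (cells X)" and inj: "inj_on f (cells X)"
    and R: "reduced_form X f R" and S: "reduced_form X f S"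
  shows "pivots X f R \<subseteq> pivots X f S"
proof clarify
  fix s t assume st: "(s, t) \<in> pivots X f R"
  then have t: "s \<in> cells X" "t \<in> cells X" by (auto simp: pivots_def pivot_in_row_def)
  obtain V where V: "R = (\<lambda>x u. chain_boundary X (\<lambda>y. V y u) x)" "unitriangular X f V"
    and redR: "inj_on fst (pivots X f R)"
    using R unfolding reduced_form_iff[OF inj] by blast
  obtain W where W: "S = (\<lambda>x u. chain_boundary X (\<lambda>y. W y u) x)" "unitriangular X f W"
    and redS: "inj_on fst (pivots X f S)"
    using S unfolding reduced_form_iff[OF inj] by blast
  have "\<exists>x\<in>cells X. chain_boundary X (\<lambda>y. W y t) x \<noteq> 0 \<and> f s \<le> f x"
    using W(2) t by (intro pivot_minimal[OF fin inj V(2,1) redR st]) (auto simp: unitriangular_def)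
  then obtain s' where s': "(s', t) \<in> pivots X f S" "f s \<le> f s'"
    using pivot_exists[OF fin _ t(2), of _ S f] W(1) by (metis order_trans)
  have "\<exists>x\<in>cells X. chain_boundary X (\<lambda>y. V y t) x \<noteq> 0 \<and> f s' \<le> f x"
    using V(2) t by (intro pivot_minimal[OF fin inj W(2,1) redS s'(1)]) (auto simp: unitriangular_def)
  then have "f s' \<le> f s"
    using st V(1) by (force simp: pivots_def pivot_in_row_def)
  then have "s' = s"
    using s' t inj by (auto simp: pivots_def pivot_in_row_def dest: inj_onD)
  then show "(s, t) \<in> pivots X f S" using s' by simp
qed

lemma BD_eq_pivots:
  assumes "finite (cells X)" "inj_on f (cells X)" "reduced_form X f R"
  shows "BD X f = pivots X f R"
  unfolding BD_def pivots_def[symmetric]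
  using pivots_subset[OF assms(1,2)] assms(3) by (intro the_equality) blast+


section \<open>Canceling one shallow pair\<close>

locale filtered_complex =
  fixes X :: "('a, 'k::field) complex_data" and f :: "'a \<Rightarrow> real"
  assumes lefschetz: "lefschetz_complex X" and filter_on: "is_filter_on X f"
begin

lemma finite_cells: "finite (cells X)"
  using lefschetz by (simp add: lefschetz_complex_def)

lemma inj_filter: "inj_on f (cells X)"
  using filter_on by (simp add: is_filter_on_def)

lemma square_zero: "z \<in> cells X \<Longrightarrow> x \<in> cells X \<Longrightarrow> (\<Sum>y\<in>cells X. inc X z y * inc X y x) = 0"
  using lefschetz by (simp add: lefschetz_complex_def)

lemma inc_less: "y \<in> cells X \<Longrightarrow> x \<in> cells X \<Longrightarrow> inc X y x \<noteq> 0 \<Longrightarrow> f x < f y"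
  using filter_on by (auto simp: is_filter_on_def facet_def)

end

locale shallow_pair = filtered_complex X f
  for X :: "('a, 'k::field) complex_data" and f +
  fixes s t :: 'a
  assumes shallow: "(s, t) \<in> SH X f"
begin

abbreviation "Y \<equiv> cancel (s, t) X"

lemma st_cells: "s \<in> cells X" "t \<in> cells X" and inc_ts: "inc X t s \<noteq> 0"
  using shallow by (auto simp: SH_def facet_def)

lemma f_facet: "x \<in> cells X \<Longrightarrow> inc X t x \<noteq> 0 \<Longrightarrow> f x \<le> f s"
  and f_cofacet: "y \<in> cells X \<Longrightarrow> inc X y s \<noteq> 0 \<Longrightarrow> f t \<le> f y"
  using shallow by (auto simp: SH_def facet_def)

lemma st_less: "f s < f t"
  using inc_less st_cells inc_ts by blast

lemma st_neq: "s \<noteq> t"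
  using st_less by blast

lemma cells_Y: "cells Y = cells X - {s, t}"
  by (simp add: cancel_def)

lemma cells_X: "cells X = insert s (insert t (cells Y))"
  using st_cells by (auto simp: cells_Y)

lemma inc_Y: "inc Y y x = inc X y x - inverse (inc X t s) * inc X y s * inc X t x"
  by (simp add: cancel_def)

lemma inc_Y_t: "inc Y t x = 0" and inc_Y_s: "inc Y y s = 0"
  using inc_ts by (simp_all add: inc_Y)

lemma inc_Y_cases:
  assumes "inc Y y x \<noteq> 0"
  obtains "inc X y x \<noteq> 0" | "inc X y s \<noteq> 0" "inc X t x \<noteq> 0"
  using assms by (force simp: inc_Y)

text \<open>
  As \<open>s\<close> and \<open>t\<close> contribute nothing to the incidence products of the quotient
  (\<open>inc_Y_s\<close>, \<open>inc_Y_t\<close>), sums over the cells of the quotient are conveniently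
  computed over all cells, where the boundary map of \<open>X\<close> squares to zero.
\<close>

lemma sum_cells: "(\<Sum>y\<in>cells X. g y) = g s + g t + (\<Sum>y\<in>cells Y. g y)" for g :: "'a \<Rightarrow> 'k"
  using finite_cells st_neq unfolding cells_X by (simp add: cells_Y add.assoc)

lemma inc_Y_inc_X:
  assumes "z \<in> cells X" "x \<in> cells X"
  shows "(\<Sum>y\<in>cells X. inc Y z y * inc X y x) = 0"
proof -
  have "(\<Sum>y\<in>cells X. inc Y z y * inc X y x) =
    (\<Sum>y\<in>cells X. inc X z y * inc X y x) -
    inverse (inc X t s) * inc X z s * (\<Sum>y\<in>cells X. inc X t y * inc X y x)"
    by (simp add: inc_Y algebra_simps sum_subtractf sum_distrib_left)
  then show ?thesis using square_zero assms st_cells by simp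
qed

lemma filtered_complex_Y: "filtered_complex Y f"
proof
  have "(\<Sum>y\<in>cells Y. inc Y z y * inc Y y x) = 0" if "z \<in> cells Y" "x \<in> cells Y" for z x
  proof -
    have "(\<Sum>y\<in>cells Y. inc Y z y * inc Y y x) = (\<Sum>y\<in>cells X. inc Y z y * inc Y y x)"
      by (simp add: sum_cells inc_Y_s inc_Y_t)
    also have "\<dots> = (\<Sum>y\<in>cells X. inc Y z y * inc X y x) -
        inverse (inc X t s) * inc X t x * (\<Sum>y\<in>cells X. inc Y z y * inc X y s)"
      by (simp add: inc_Y[of _ x] algebra_simps sum_subtractf sum_distrib_left)
    finally show ?thesis using inc_Y_inc_X that st_cells by (simp add: cells_Y)
  qed
  moreover have "cell_dim Y y = cell_dim Y x + 1"
    if "y \<in> cells Y" "x \<in> cells Y" "inc Y y x \<noteq> 0" for x y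
    using that(3)
  proof (cases rule: inc_Y_cases)
    case 1
    then show ?thesis using that lefschetz by (simp add: cells_Y lefschetz_complex_def) (simp add: cancel_def)
  next
    case 2
    have "cell_dim X b = cell_dim X a + 1" if "b \<in> cells X" "a \<in> cells X" "inc X b a \<noteq> 0" for a b
      using lefschetz that by (simp add: lefschetz_complex_def)
    from this[of y s] this[of t x] this[of t s] show ?thesis
      using 2 that st_cells inc_ts by (simp add: cells_Y) (simp add: cancel_def)
  qed
  ultimately show "lefschetz_complex Y"
    using finite_cells by (simp add: lefschetz_complex_def cells_Y)
  have "f x < f y" if "facet Y x y" for x y
  proof -
    have xy: "y \<in> cells X" "x \<in> cells X" "inc Y y x \<noteq> 0"
      using that by (auto simp: facet_def cells_Y)
    from xy(3) show ?thesis
    proof (cases rule: inc_Y_cases)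
      case 1
      then show ?thesis using inc_less xy by blast
    next
      case 2
      then show ?thesis using f_cofacet[of y] inc_less[of t x] xy st_cells by simp
    qed
  qed
  moreover have "inj_on f (cells Y)"
    using inj_filter by (rule inj_on_subset) (auto simp: cells_Y)
  ultimately show "is_filter_on Y f" by (simp add: is_filter_on_def)
qed

text \<open>
  Two shallow pairs sharing their first or their second cell agree because the largest facet and
  the smallest cofacet are unique. A chain of two shallow pairs \<open>(a, b)\<close>, \<open>(b, c)\<close>
  contradicts that the boundary map squares to zero: any other cell between \<open>a\<close> and
  \<open>c\<close> would come after \<open>b\<close> as a cofacet of \<open>a\<close> and before
  \<open>b\<close> as a facet of \<open>c\<close>, so the path through \<open>b\<close> has nothing to
  cancel against.
\<close>

lemma shallow_pairs_disjoint:
  assumes "(s', t') \<in> SH X f" "(s', t') \<noteq> (s, t)"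
  shows "{s', t'} \<inter> {s, t} = {}"
proof -
  interpret P: shallow_pair X f s' t' using assms(1) by unfold_locales
  have eqI: "x = y" if "f x \<le> f y" "f y \<le> f x" "x \<in> cells X" "y \<in> cells X" for x y
    using that inj_filter by (auto dest: inj_onD)
  have "s' \<noteq> s"
    using assms(2) eqI[of t t'] f_cofacet[of t'] P.f_cofacet[of t] inc_ts P.inc_ts
      st_cells P.st_cells by metis
  moreover have "t' \<noteq> t"
    using assms(2) eqI[of s s'] f_facet[of s'] P.f_facet[of s] inc_ts P.inc_ts
      st_cells P.st_cells by metis
  moreover have False if "(a, b) \<in> SH X f" "(b, c) \<in> SH X f" for a b c
  proof -
    interpret A: shallow_pair X f a b using that by unfold_locales
    interpret B: shallow_pair X f b c using that by unfold_locales
    have "(\<Sum>y\<in>cells X. inc X c y * inc X y a) = inc X c b * inc X b a"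
    proof (subst sum.remove[of _ b])
      have "inc X c y * inc X y a = 0" if "y \<in> cells X - {b}" for y
        using that A.f_cofacet[of y] B.f_facet[of y] eqI[of b y] A.st_cells
        by (metis DiffE insertI1 mult_eq_0_iff)
      then show "inc X c b * inc X b a + (\<Sum>y\<in>cells X - {b}. inc X c y * inc X y a) =
          inc X c b * inc X b a" by (simp add: sum.neutral)
    qed (use finite_cells A.st_cells in auto)
    then show False
      using square_zero A.st_cells B.st_cells A.inc_ts B.inc_ts by simp
  qed
  then have "s' \<noteq> t" "t' \<noteq> s" using shallow assms(1) by auto
  ultimately show ?thesis by auto
qed

text \<open>
  The incidence of \<open>s'\<close> and \<open>t'\<close> could only change if \<open>s\<close> were a facet
  of \<open>t'\<close> and \<open>s'\<close> one of \<open>t\<close>, which would force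
  \<open>t = t'\<close>. A new facet of \<open>t'\<close> is a facet of \<open>t\<close>, so it is
  bounded by \<open>s\<close>, which is then itself a facet of \<open>t'\<close>; dually for cofacets.
\<close>

lemma shallow_pair_survives:
  assumes "(s', t') \<in> SH X f" "(s', t') \<noteq> (s, t)"
  shows "(s', t') \<in> SH Y f"
proof -
  interpret P: shallow_pair X f s' t' using assms(1) by unfold_locales
  note disj = shallow_pairs_disjoint[OF assms]
  have "\<not> (inc X t' s \<noteq> 0 \<and> inc X t s' \<noteq> 0)"
    using f_cofacet[of t'] P.f_cofacet[of t] st_cells P.st_cells disj
      inj_onD[OF inj_filter, of t t'] by (metis antisym disjoint_iff insertI1 insert_commute)
  then have "inc Y t' s' = inc X t' s'" by (auto simp: inc_Y)
  then have "facet Y s' t'"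
    using P.inc_ts P.st_cells disj by (auto simp: facet_def cells_Y)
  moreover have "f x \<le> f s'" if "facet Y x t'" for x
  proof -
    have x: "x \<in> cells X" "inc Y t' x \<noteq> 0" using that by (auto simp: facet_def cells_Y)
    from x(2) show ?thesis
      by (cases rule: inc_Y_cases)
        (use x f_facet[of x] P.f_facet[of x] P.f_facet[of s] st_cells in auto)
  qed
  moreover have "f t' \<le> f y" if "facet Y s' y" for y
  proof -
    have y: "y \<in> cells X" "inc Y y s' \<noteq> 0" using that by (auto simp: facet_def cells_Y)
    from y(2) show ?thesis
      by (cases rule: inc_Y_cases)
        (use y f_cofacet[of y] P.f_cofacet[of y] P.f_cofacet[of t] st_cells in auto)
  qed
  ultimately show ?thesis by (simp add: SH_def)
qed


text \<open>
  The chain map from the quotient to \<open>X\<close>: the coefficient at \<open>t\<close> is the one that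
  makes the coefficient at \<open>s\<close> of the boundary vanish.
\<close>

definition lift :: "('a \<Rightarrow> 'k) \<Rightarrow> 'a \<Rightarrow> 'k" where
  "lift c x = (if x = s then 0
     else if x = t then - inverse (inc X t s) * (\<Sum>z\<in>cells Y. inc X z s * c z)
     else c x)"

lemma lift_Y: "x \<in> cells Y \<Longrightarrow> lift c x = c x"
  and lift_s: "lift c s = 0"
  by (auto simp: lift_def cells_Y)

text \<open>
  This is why the chain map preserves leading cells and pivots: a chain that acquires a coefficient
  at \<open>t\<close> contains a cofacet of \<open>s\<close> other than \<open>t\<close>, and by shallowness
  these come after \<open>t\<close>.
\<close>

lemma lift_t_nonzero:
  assumes "lift c t \<noteq> 0"
  obtains z where "z \<in> cells Y" "c z \<noteq> 0" "f t < f z"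
proof -
  from assms have "(\<Sum>z\<in>cells Y. inc X z s * c z) \<noteq> 0"
    using st_neq by (auto simp: lift_def)
  then obtain z where z: "z \<in> cells Y" "inc X z s * c z \<noteq> 0"
    by (meson sum.neutral)
  then have "f t \<le> f z" "f t \<noteq> f z"
    using f_cofacet inj_filter st_cells by (auto simp: cells_Y dest: inj_onD)
  then show thesis using that z by auto
qed

text \<open>
  Off the canceled pair this is the incidence formula of the quotient. Agreement at \<open>t\<close> is
  where \<open>X\<close> being a complex enters: by \<open>inc_Y_inc_X\<close>, the coefficient at
  \<open>t\<close> of a boundary is determined by the coefficients at the cells of the quotient.
\<close>

lemma boundary_lift:
  assumes x: "x \<in> cells X"
  shows "chain_boundary X (lift c) x = lift (chain_boundary Y c) x"
proof -
  have "chain_boundary X (lift c) x = inc X t x * lift c t + (\<Sum>y\<in>cells Y. inc X y x * c y)"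
    by (simp add: chain_boundary_def sum_cells lift_s lift_Y)
  also have "\<dots> = chain_boundary Y c x"
    using st_neq
    by (simp add: lift_def chain_boundary_def inc_Y algebra_simps sum_subtractf sum_negf sum_distrib_left)
  finally have eq: "chain_boundary X (lift c) x = chain_boundary Y c x" .
  \<comment> \<open>The incidence of the quotient is a formula on all cells, so the right-hand side makes sense
    also at \<open>s\<close> and \<open>t\<close>; it remains to compare it with \<open>lift\<close> there.\<close>
  have "chain_boundary Y c t = lift (chain_boundary Y c) t"
  proof -
    have "inc Y y t = - inverse (inc X t s) * (\<Sum>z\<in>cells Y. inc Y y z * inc X z s)"
      if "y \<in> cells Y" for y
    proof -
      have "inc Y y t * inc X t s + (\<Sum>z\<in>cells Y. inc Y y z * inc X z s) = 0"
        using inc_Y_inc_X[of y s] that st_cells by (simp add: sum_cells inc_Y_s cells_Y)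
      then have "(\<Sum>z\<in>cells Y. inc Y y z * inc X z s) = - (inc Y y t * inc X t s)"
        by (simp add: eq_neg_iff_add_eq_0 add.commute)
      then show ?thesis using inc_ts by simp
    qed
    then have "chain_boundary Y c t =
      (\<Sum>y\<in>cells Y. - inverse (inc X t s) * (\<Sum>z\<in>cells Y. inc Y y z * inc X z s) * c y)"
      by (simp add: chain_boundary_def)
    also have "\<dots> = - inverse (inc X t s) *
        (\<Sum>y\<in>cells Y. \<Sum>z\<in>cells Y. inc X z s * (inc Y y z * c y))"
      by (simp add: sum_distrib_left sum_distrib_right sum_negf mult_ac)
    also have "(\<Sum>y\<in>cells Y. \<Sum>z\<in>cells Y. inc X z s * (inc Y y z * c y)) =
        (\<Sum>z\<in>cells Y. inc X z s * chain_boundary Y c z)"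
      by (subst sum.swap) (simp add: chain_boundary_def sum_distrib_left)
    finally show ?thesis using st_neq by (simp add: lift_def)
  qed
  moreover have "chain_boundary Y c s = lift (chain_boundary Y c) s"
    by (simp add: chain_boundary_def inc_Y_s lift_s)
  ultimately show ?thesis
    using eq x lift_Y[of x "chain_boundary Y c"]
    by (cases "x = s"; cases "x = t") (auto simp: cells_Y)
qed

lemma reduced_form_lift:
  assumes "reduced_form Y f R'"
  obtains R where "reduced_form X f R" "pivots X f R = insert (s, t) (pivots Y f R')"
proof -
  interpret Y: filtered_complex Y f by (rule filtered_complex_Y)
  obtain W where R': "R' = (\<lambda>x u. chain_boundary Y (\<lambda>y. W y u) x)"
    and W: "unitriangular Y f W" and red: "inj_on fst (pivots Y f R')"
    using assms unfolding reduced_form_iff[OF Y.inj_filter] by blast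
  \<comment> \<open>Column \<open>s\<close> is the boundary of \<open>t\<close>, scaled to have coefficient \<open>1\<close> at
    \<open>s\<close>, so that column \<open>s\<close> of \<open>R\<close> is zero.\<close>
  define V where "V x u =
    (if u = t then if x = t then 1 else 0
     else if u = s then inverse (inc X t s) * inc X t x
     else lift (\<lambda>y. W y u) x)" for x u
  define R where "R = (\<lambda>x u. chain_boundary X (\<lambda>y. V y u) x)"
  have "unitriangular X f V"
    unfolding unitriangular_def
  proof (intro conjI ballI impI)
    fix x assume "x \<in> cells X"
    then show "V x x = 1"
      using inc_ts W by (auto simp: V_def lift_Y cells_Y unitriangular_def)
  next
    fix x u assume xu: "x \<in> cells X" "u \<in> cells X" "V x u \<noteq> 0"
    consider "u = t" | "u = s" | "u \<in> cells Y" using xu by (auto simp: cells_Y)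
    then show "f x \<le> f u"
    proof cases
      case 1
      then show ?thesis using xu by (auto simp: V_def split: if_splits)
    next
      case 2
      then show ?thesis using xu f_facet st_neq by (auto simp: V_def)
    next
      case 3
      then have nz: "lift (\<lambda>y. W y u) x \<noteq> 0" using xu by (auto simp: V_def cells_Y)
      consider "x = t" | "x \<in> cells Y" using xu nz lift_s by (auto simp: cells_Y)
      then show ?thesis
      proof cases
        case 1
        then obtain z where "z \<in> cells Y" "W z u \<noteq> 0" "f t < f z"
          using nz by (auto elim: lift_t_nonzero)
        then show ?thesis using 1 3 W by (auto simp: unitriangular_def intro: order_trans less_imp_le)
      next
        case 2
        then show ?thesis using nz 3 W by (simp add: lift_Y unitriangular_def)
      qed
    qed
  qed
  have R_t: "R x t = inc X t x" for x
  proof -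
    have "R x t = (\<Sum>y\<in>cells X. if y = t then inc X t x else 0)"
      unfolding R_def V_def chain_boundary_def by (intro sum.cong) auto
    then show ?thesis using finite_cells st_cells by simp
  qed
  have R_s: "R x s = 0" if "x \<in> cells X" for x
  proof -
    have "R x s = inverse (inc X t s) * (\<Sum>y\<in>cells X. inc X t y * inc X y x)"
      using st_neq by (simp add: R_def V_def chain_boundary_def sum_distrib_left mult_ac)
    then show ?thesis using square_zero that st_cells by simp
  qed
  have R_Y: "R x u = lift (\<lambda>y. R' y u) x" if "x \<in> cells X" "u \<in> cells Y" for x u
    using that boundary_lift[of x "\<lambda>y. W y u"] by (auto simp: R_def R' V_def cells_Y)
  have "pivot_in_row X f R p u \<longleftrightarrow> (p, u) = (s, t) \<or> pivot_in_row Y f R' p u" for p u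
  proof -
    consider "u \<notin> cells X" | "u = t" | "u = s" | "u \<in> cells Y" by (auto simp: cells_Y)
    then show ?thesis
    proof cases
      case 1
      then show ?thesis using st_cells by (auto simp: pivot_in_row_def cells_Y)
    next
      case 2
      have "pivot_in_row X f R p t \<longleftrightarrow> p = s"
        using st_cells inc_ts f_facet inj_filter
        by (auto simp: pivot_in_row_def R_t intro: antisym dest: inj_onD)
      then show ?thesis using 2 by (auto simp: pivot_in_row_def cells_Y)
    next
      case 3
      then show ?thesis using R_s st_neq by (auto simp: pivot_in_row_def cells_Y)
    next
      case 4
      show ?thesis
      proof
        assume "pivot_in_row X f R p u"
        then have p: "p \<in> cells X" "lift (\<lambda>y. R' y u) p \<noteq> 0"
          and max: "\<And>x. x \<in> cells X \<Longrightarrow> lift (\<lambda>y. R' y u) x \<noteq> 0 \<Longrightarrow> f x \<le> f p"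
          using 4 by (auto simp: pivot_in_row_def R_Y)
        have max': "f x \<le> f p" if "x \<in> cells Y" "R' x u \<noteq> 0" for x
          using max[of x] that by (simp add: lift_Y) (simp add: cells_Y)
        \<comment> \<open>A non-zero entry in row \<open>t\<close> forces one further down in the column.\<close>
        have "p \<noteq> t"
          using p(2) max' by (auto elim!: lift_t_nonzero dest: leD)
        moreover have "p \<noteq> s" using p(2) lift_s by auto
        ultimately have "p \<in> cells Y" using p(1) by (simp add: cells_Y)
        then show "(p, u) = (s, t) \<or> pivot_in_row Y f R' p u"
          using 4 p(2) max' by (simp add: pivot_in_row_def lift_Y)
      next
        assume "(p, u) = (s, t) \<or> pivot_in_row Y f R' p u"
        then have p: "p \<in> cells Y" "R' p u \<noteq> 0"
          and max: "\<And>x. x \<in> cells Y \<Longrightarrow> R' x u \<noteq> 0 \<Longrightarrow> f x \<le> f p"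
          using 4 by (auto simp: pivot_in_row_def cells_Y)
        have "f x \<le> f p" if "x \<in> cells X" "lift (\<lambda>y. R' y u) x \<noteq> 0" for x
        proof -
          have "x \<noteq> s" using that(2) lift_s by auto
          show ?thesis
          proof (cases "x = t")
            case True
            then have "lift (\<lambda>y. R' y u) t \<noteq> 0" using that(2) by simp
            then obtain z where z: "z \<in> cells Y" "R' z u \<noteq> 0" "f t < f z"
              by (rule lift_t_nonzero)
            then show ?thesis using max[OF z(1,2)] True by simp
          next
            case False
            then have "x \<in> cells Y" using that(1) \<open>x \<noteq> s\<close> by (simp add: cells_Y)
            then show ?thesis using that(2) max by (simp add: lift_Y)
          qed
        qed
        then show "pivot_in_row X f R p u"
          using p 4 by (auto simp: pivot_in_row_def R_Y lift_Y cells_X)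
      qed
    qed
  qed
  then have piv: "pivots X f R = insert (s, t) (pivots Y f R')"
    by (auto simp: pivots_def)
  have "fst ` pivots Y f R' \<subseteq> cells Y"
    by (auto simp: pivots_def pivot_in_row_def)
  then have "s \<notin> fst ` pivots Y f R'" by (auto simp: cells_Y)
  then have "inj_on fst (insert (s, t) (pivots Y f R'))"
    using red by (auto simp: inj_on_insert)
  then have "reduced_form X f R"
    unfolding reduced_form_iff[OF inj_filter] piv
    using \<open>unitriangular X f V\<close> R_def by blast
  then show thesis using that piv by blast
qed

end


section \<open>Sequences of shallow cancellations\<close>

lemma fold_cancel:
  fixes X :: "('a, 'k::field) complex_data"
  assumes "filtered_complex X f" "distinct ps" "set ps \<subseteq> SH X f"
  defines "Y \<equiv> fold cancel ps X"
  shows "filtered_complex Y f"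
    and "cells Y = cells X - (\<Union>(s, t)\<in>set ps. {s, t})"
    and "reduced_form Y f R' \<Longrightarrow> \<exists>R. reduced_form X f R \<and> pivots X f R = set ps \<union> pivots Y f R'"
  using assms(1-3) unfolding Y_def
proof (induction ps arbitrary: X)
  case Nil
  {
    case 1 then show ?case by simp
  next
    case 2 then show ?case by simp
  next
    case 3 then show ?case by auto
  }
next
  case (Cons p ps)
  obtain s t where p: "p = (s, t)" by force
  have step: "filtered_complex (cancel p X) f" "set ps \<subseteq> SH (cancel p X) f" "distinct ps"
      "cells (cancel p X) = cells X - {s, t}"
      "reduced_form (cancel p X) f S \<Longrightarrow>
        \<exists>R. reduced_form X f R \<and> pivots X f R = insert p (pivots (cancel p X) f S)"
    if "filtered_complex X f" "distinct (p # ps)" "set (p # ps) \<subseteq> SH X f"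
    for S and X :: "('a, 'k) complex_data"
  proof -
    interpret shallow_pair X f s t
      using that by (auto simp: p shallow_pair_def shallow_pair_axioms_def)
    show "filtered_complex (cancel p X) f" using filtered_complex_Y by (simp add: p)
    show "set ps \<subseteq> SH (cancel p X) f" "distinct ps"
      using that p by (auto intro!: shallow_pair_survives)
    show "cells (cancel p X) = cells X - {s, t}" using cells_Y by (simp add: p)
    show "\<exists>R. reduced_form X f R \<and> pivots X f R = insert p (pivots (cancel p X) f S)"
      if "reduced_form (cancel p X) f S"
      using that reduced_form_lift unfolding p by metis
  qed
  {
    case 1
    note st = step[OF 1]
    show ?case using Cons.IH(1)[OF st(1,3,2)] by simp
  next
    case 2
    note st = step[OF 2]
    show ?case using Cons.IH(2)[OF st(1,3,2)] st(4) p by auto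
  next
    case 3
    note st = step[OF 3(2-4)]
    from 3(1) have "reduced_form (fold cancel ps (cancel p X)) f R'" by simp
    from Cons.IH(3)[OF this st(1,3,2)]
    obtain S where "reduced_form (cancel p X) f S"
        "pivots (cancel p X) f S = set ps \<union> pivots (fold cancel ps (cancel p X)) f R'" by auto
    with st(5) show ?case by fastforce
  }
qed

lemma boundaryless_reduced_form:
  assumes "boundaryless X" "inj_on f (cells X)"
  obtains R where "reduced_form X f R" "pivots X f R = {}"
proof -
  let ?R = "\<lambda>x u. chain_boundary X (\<lambda>y. identity_matrix y u) x"
  have "?R x u = 0" if "x \<in> cells X" for x u
    using assms(1) that by (simp add: chain_boundary_def boundaryless_def)
  then have piv: "pivots X f ?R = {}" by (auto simp: pivots_def pivot_in_row_def)
  have "unitriangular X f identity_matrix"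
    by (auto simp: unitriangular_def identity_matrix_def)
  then have "reduced_form X f ?R"
    using piv unfolding reduced_form_iff[OF assms(2)] by auto
  then show thesis using piv that by blast
qed

theorem theorem6p5:
  fixes X :: "('a, 'k::field) complex_data"
    and f :: "'a \<Rightarrow> real"
    and Xs :: "nat \<Rightarrow> ('a, 'k) complex_data"
    and V :: "nat \<Rightarrow> ('a \<times> 'a) set"
  assumes "lefschetz_complex X"
    and "is_filter_on X f"
    and "shallow_cancellations X f Xs V"
    and "\<And>i. \<not> boundaryless (Xs i) \<Longrightarrow> V i \<noteq> {}"
  shows "\<exists>n. boundaryless (Xs n) \<and>
             BD X f = (\<Union>i<n. V i) \<and>
             disjoint_family_on V {..<n}"
proof -
  have X0: "Xs 0 = X" and V: "V i \<subseteq> SH (Xs i) f" and Q: "is_quotient (Xs i) (V i) (Xs (Suc i))" for i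
    using assms(3) by (auto simp: shallow_cancellations_def)
  obtain ps where ps: "\<And>i. distinct (ps i)" "\<And>i. set (ps i) = V i"
      "\<And>i. Xs (Suc i) = fold cancel (ps i) (Xs i)"
    using Q unfolding is_quotient_def by metis
  have filt: "filtered_complex (Xs i) f" for i
  proof (induction i)
    case 0
    then show ?case using assms(1,2) by (simp add: X0 filtered_complex_def)
  next
    case (Suc i)
    then show ?case using fold_cancel(1)[OF Suc, of "ps i"] ps V by simp
  qed
  have cells_Suc: "cells (Xs (Suc i)) = cells (Xs i) - (\<Union>(s, t)\<in>V i. {s, t})" for i
    using fold_cancel(2)[OF filt, of "ps i" i] ps V by simp
  have V_cells: "s \<in> cells (Xs i)" if "(s, t) \<in> V i" for s t i
    using subsetD[OF V that] by (simp add: SH_def facet_def)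
  have anti: "cells (Xs j) \<subseteq> cells (Xs i)" if "i \<le> j" for i j
    using that by (rule lift_Suc_antimono_le[rotated]) (auto simp: cells_Suc)
  have fin: "finite (cells (Xs i))" for i
    using filt filtered_complex.finite_cells by blast
  have "\<exists>n. boundaryless (Xs n)"
  proof (rule ccontr)
    assume "\<not> ?thesis"
    then have "V i \<noteq> {}" for i using assms(4) by blast
    have "cells (Xs (Suc i)) \<subset> cells (Xs i)" for i
    proof -
      obtain s t where "(s, t) \<in> V i" using \<open>V i \<noteq> {}\<close> by auto
      then have "s \<in> cells (Xs i)" "s \<notin> cells (Xs (Suc i))"
        using V_cells by (auto simp: cells_Suc)
      then show ?thesis using anti[of i "Suc i"] by auto
    qed
    then have "(Xs (Suc i), Xs i) \<in> inv_image finite_psubset cells" for i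
      using fin by simp
    then show False
      using wf_inv_image[OF wf_finite_psubset, of "cells :: ('a, 'k) complex_data \<Rightarrow> 'a set"]
      unfolding wf_iff_no_infinite_down_chain by blast
  qed
  then obtain n where n: "boundaryless (Xs n)" by blast
  \<comment> \<open>Lift the zero matrix of \<open>Xs n\<close> back through the sequence.\<close>
  have "\<exists>R. reduced_form (Xs i) f R \<and> pivots (Xs i) f R = (\<Union>j\<in>{i..<n}. V j)" if "i \<le> n" for i
    using that
  proof (induction rule: inc_induct)
    case base
    show ?case
      using boundaryless_reduced_form[OF n filtered_complex.inj_filter[OF filt]] by auto
  next
    case (step i)
    then obtain R' where R': "reduced_form (Xs (Suc i)) f R'"
      "pivots (Xs (Suc i)) f R' = (\<Union>j\<in>{Suc i..<n}. V j)" by blast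
    have "\<exists>R. reduced_form (Xs i) f R \<and> pivots (Xs i) f R = V i \<union> pivots (Xs (Suc i)) f R'"
      using fold_cancel(3)[OF filt, of "ps i" i R'] R' ps V by simp
    moreover have "{i..<n} = insert i {Suc i..<n}" using step by auto
    ultimately show ?case using R' by simp
  qed
  from this[of 0] obtain R where "reduced_form X f R" "pivots X f R = (\<Union>i<n. V i)"
    by (auto simp: X0 lessThan_atLeast0)
  then have "BD X f = (\<Union>i<n. V i)"
    using BD_eq_pivots[of X f R] fin[of 0] filtered_complex.inj_filter[OF filt[of 0]]
    by (simp add: X0)
  moreover have "V i \<inter> V j = {}" if "i < j" for i j
  proof -
    have "s \<in> cells (Xs j)" if "(s, t) \<in> V j" for s t
      using V_cells that by blast
    moreover have "s \<notin> cells (Xs j)" if "(s, t) \<in> V i" for s t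
      using anti[of "Suc i" j] \<open>i < j\<close> that by (auto simp: cells_Suc)
    ultimately show ?thesis by auto
  qed
  then have "disjoint_family_on V {..<n}"
    unfolding disjoint_family_on_def by (metis Int_commute linorder_neqE_nat)
  ultimately show ?thesis using n by blast
qed

end
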